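(* There exists a connected undirected graph $G$ for which there is no natural isomorphism $\psi_G:\mathbf{C}\mathcal{T}(G)\to\mathbf{C}K(G)$; that is, there is no assignment, to each graph $H$ isomorphic to $G$, of a vector space isomorphism $\psi_H:\mathbf{C}\mathcal{T}(H)\to\mathbf{C}K(H)$ such that $\psi_{H'}\circ f_{\mathcal{T}}=f_K\circ\psi_H$ for every graph isomorphism $f:H\to H'$ between such graphs.
   Context: Graphs are finite multigraphs; an undirected edge is regarded as a pair of oppositely oriented directed edges. For a graph $G=(V,E)$, $A(G)$ is the $V\times V$ matrix whose $(v,w)$-entry is the number of directed edges from $v$ to $w$, $\Delta(G)$ is diagonal with $\Delta_{vv}=\sum_wA_{vw}$, and $Q(G)=\Delta(G)-A(G)$. The critical group is $\mathcal{K}(G)=\mathbf{Z}^V/Q(G)^{\dagger}\mathbf{Z}^V$ ($\dagger$ = transpose) and $K(G)$ is its torsion subgroup. $\mathcal{T}(G)$ is the set of spanning trees of $G$, and $\mathbf{C}\mathcal{T}(G)$, $\mathbf{C}K(G)$ denote the complex vector spaces with bases $\mathcal{T}(G)$ and $K(G)$ respectively. For a graph isomorphism $f:G\to H$, $f_{\mathcal{T}}:\mathbf{C}\mathcal{T}(G)\to\mathbf{C}\mathcal{T}(H)$ is the linear extension of the map sending each spanning tree to its image under $f$; and with $\Phi$ the $V(H)\times V(G)$ matrix with $\Phi_{vw}=1$ if $f(w)=v$ and $0$ otherwise, $f$ induces the group isomorphism $\mathcal{K}(G)\to\mathcal{K}(H)$, $\mathbf{x}+Q(G)^{\dagger}\mathbf{Z}^{V(G)}\mapsto\Phi\mathbf{x}+Q(H)^{\dagger}\mathbf{Z}^{V(H)}$,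 whose restriction $K(G)\to K(H)$ extended linearly is denoted $f_K:\mathbf{C}K(G)\to\mathbf{C}K(H)$. *)

theory Defs
  imports
    Complex_Main
    "HOL-Algebra.Product_Groups"
    "Graph_Theory.Digraph_Component"
    "Graph_Theory.Bidirected_Digraph"
begin

text \<open>
  An undirected multigraph is a finite multidigraph together with an involution \<open>reversal\<close>
  that pairs every directed edge with an oppositely oriented one; an undirected edge is a pair
  \<open>{a, reversal a}\<close>. Loops and parallel edges are allowed.
\<close>

record ('v, 'e) multigraph =
  dir :: "('v, 'e) pre_digraph"
  reversal :: "'e \<Rightarrow> 'e"

definition undirected_graph :: "('v, 'e) multigraph \<Rightarrow> bool" where
  "undirected_graph G \<longleftrightarrow> fin_digraph (dir G) \<and> bidirected_digraph (dir G) (reversal G)"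

record ('v, 'e, 'w, 'f) graph_map =
  on_verts :: "'v \<Rightarrow> 'w"
  on_arcs :: "'e \<Rightarrow> 'f"

definition graph_isomorphism ::
  "('v, 'e, 'w, 'f) graph_map \<Rightarrow> ('v, 'e) multigraph \<Rightarrow> ('w, 'f) multigraph \<Rightarrow> bool" where
  "graph_isomorphism f G H \<longleftrightarrow>
     undirected_graph G \<and> undirected_graph H \<and>
     bij_betw (on_verts f) (verts (dir G)) (verts (dir H)) \<and>
     bij_betw (on_arcs f) (arcs (dir G)) (arcs (dir H)) \<and>
     (\<forall>a \<in> arcs (dir G).
        tail (dir H) (on_arcs f a) = on_verts f (tail (dir G) a) \<and>
        head (dir H) (on_arcs f a) = on_verts f (head (dir G) a) \<and>
        reversal H (on_arcs f a) = on_arcs f (reversal G a))"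

definition isomorphic_graphs :: "('v, 'e) multigraph \<Rightarrow> ('w, 'f) multigraph \<Rightarrow> bool" where
  "isomorphic_graphs G H \<longleftrightarrow> (\<exists>f. graph_isomorphism f G H)"

text \<open>
  A spanning tree is given by its edge set, i.e. a set of directed edges closed under reversal.
  The library predicate \<^const>\<open>forest\<close> is not applicable, because a directed edge followed by
  its reversal is a \<^const>\<open>pre_digraph.cycle\<close>; a cycle of an undirected graph does not traverse
  the same undirected edge in both directions.
\<close>

definition spanning_subgraph :: "('v, 'e) multigraph \<Rightarrow> 'e set \<Rightarrow> ('v, 'e) pre_digraph" where
  "spanning_subgraph G T = (dir G)\<lparr>arcs := T\<rparr>"

definition undirected_cycle :: "('v, 'e) multigraph \<Rightarrow> 'e set \<Rightarrow> 'e list \<Rightarrow> bool" where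
  "undirected_cycle G T p \<longleftrightarrow>
     pre_digraph.cycle (spanning_subgraph G T) p \<and> (\<forall>a \<in> set p. reversal G a \<notin> set p)"

definition spanning_trees :: "('v, 'e) multigraph \<Rightarrow> 'e set set" where
  "spanning_trees G = {T. T \<subseteq> arcs (dir G) \<and> reversal G ` T \<subseteq> T \<and>
     Digraph_Component.connected (spanning_subgraph G T) \<and> \<not> (\<exists>p. undirected_cycle G T p)}"

definition adjacency :: "('v, 'e) multigraph \<Rightarrow> 'v \<Rightarrow> 'v \<Rightarrow> int" where
  "adjacency G v w = int (card {a \<in> arcs (dir G). tail (dir G) a = v \<and> head (dir G) a = w})"

definition degree_matrix :: "('v, 'e) multigraph \<Rightarrow> 'v \<Rightarrow> 'v \<Rightarrow> int" where
  "degree_matrix G v w = (if v = w then \<Sum>u\<in>verts (dir G). adjacency G v u else 0)"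

definition laplacian :: "('v, 'e) multigraph \<Rightarrow> 'v \<Rightarrow> 'v \<Rightarrow> int" where
  "laplacian G v w = degree_matrix G v w - adjacency G v w"

definition mat_vec :: "'i set \<Rightarrow> 'j set \<Rightarrow> ('i \<Rightarrow> 'j \<Rightarrow> int) \<Rightarrow> ('j \<Rightarrow> int) \<Rightarrow> ('i \<Rightarrow> int)" where
  "mat_vec I J M x = (\<lambda>i\<in>I. \<Sum>j\<in>J. M i j * x j)"

definition int_vectors :: "('v, 'e) multigraph \<Rightarrow> ('v \<Rightarrow> int) monoid" where
  "int_vectors G = product_group (verts (dir G)) (\<lambda>_. integer_group)"

definition laplacian_lattice :: "('v, 'e) multigraph \<Rightarrow> ('v \<Rightarrow> int) set" where
  "laplacian_lattice G =
     mat_vec (verts (dir G)) (verts (dir G)) (\<lambda>v w. laplacian G w v) ` carrier (int_vectors G)"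

definition critical_group :: "('v, 'e) multigraph \<Rightarrow> ('v \<Rightarrow> int) set monoid" where
  "critical_group G = int_vectors G Mod laplacian_lattice G"

definition torsion_critical_group :: "('v, 'e) multigraph \<Rightarrow> ('v \<Rightarrow> int) set set" where
  "torsion_critical_group G =
     {c \<in> carrier (critical_group G).
        \<exists>n::nat. n > 0 \<and> c [^]\<^bsub>critical_group G\<^esub> n = \<one>\<^bsub>critical_group G\<^esub>}"

definition perm_matrix :: "('v, 'e, 'w, 'f) graph_map \<Rightarrow> 'w \<Rightarrow> 'v \<Rightarrow> int" where
  "perm_matrix f v w = (if on_verts f w = v then 1 else 0)"

definition vector_map ::
  "('v, 'e, 'w, 'f) graph_map \<Rightarrow> ('v, 'e) multigraph \<Rightarrow> ('w, 'f) multigraph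
     \<Rightarrow> ('v \<Rightarrow> int) \<Rightarrow> ('w \<Rightarrow> int)" where
  "vector_map f G H = mat_vec (verts (dir H)) (verts (dir G)) (perm_matrix f)"

text \<open>
  The union over the representatives of a coset is the usual way of lifting a map to a quotient;
  all its members coincide, see \<open>critical_map_coset\<close> below.
\<close>

definition critical_map ::
  "('v, 'e, 'w, 'f) graph_map \<Rightarrow> ('v, 'e) multigraph \<Rightarrow> ('w, 'f) multigraph
     \<Rightarrow> ('v \<Rightarrow> int) set \<Rightarrow> ('w \<Rightarrow> int) set" where
  "critical_map f G H c =
     (\<Union>x\<in>c. laplacian_lattice H #>\<^bsub>int_vectors H\<^esub> vector_map f G H x)"

text \<open>
  The complex vector space with basis \<open>B\<close> is the space of finitely supported functions on \<open>B\<close>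
  with pointwise operations; \<open>b \<in> B\<close> corresponds to its indicator function.
\<close>

definition complex_span :: "'b set \<Rightarrow> ('b \<Rightarrow> complex) set" where
  "complex_span B = {\<phi>. finite {b. \<phi> b \<noteq> 0} \<and> {b. \<phi> b \<noteq> 0} \<subseteq> B}"

definition linear_extension :: "('b \<Rightarrow> 'c) \<Rightarrow> ('b \<Rightarrow> complex) \<Rightarrow> ('c \<Rightarrow> complex)" where
  "linear_extension g \<phi> = (\<lambda>c. \<Sum>b | \<phi> b \<noteq> 0 \<and> g b = c. \<phi> b)"

definition vector_space_isomorphism ::
  "(('b \<Rightarrow> complex) \<Rightarrow> ('c \<Rightarrow> complex)) \<Rightarrow> ('b \<Rightarrow> complex) set \<Rightarrow> ('c \<Rightarrow> complex) set \<Rightarrow> bool" where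
  "vector_space_isomorphism L V W \<longleftrightarrow>
     bij_betw L V W \<and>
     (\<forall>x\<in>V. \<forall>y\<in>V. L (\<lambda>b. x b + y b) = (\<lambda>c. L x c + L y c)) \<and>
     (\<forall>k. \<forall>x\<in>V. L (\<lambda>b. k * x b) = (\<lambda>c. k * L x c))"

definition tree_map ::
  "('v, 'e, 'w, 'f) graph_map \<Rightarrow> ('e set \<Rightarrow> complex) \<Rightarrow> ('f set \<Rightarrow> complex)" where
  "tree_map f = linear_extension (\<lambda>T. on_arcs f ` T)"

definition critical_linear_map ::
  "('v, 'e, 'w, 'f) graph_map \<Rightarrow> ('v, 'e) multigraph \<Rightarrow> ('w, 'f) multigraph
     \<Rightarrow> (('v \<Rightarrow> int) set \<Rightarrow> complex) \<Rightarrow> (('w \<Rightarrow> int) set \<Rightarrow> complex)" where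
  "critical_linear_map f G H = linear_extension (critical_map f G H)"

lemma carrier_int_vectors: "carrier (int_vectors G) = extensional (verts (dir G))"
  by (auto simp: int_vectors_def integer_group_def PiE_def)

lemma mult_int_vectors: "x \<otimes>\<^bsub>int_vectors G\<^esub> y = (\<lambda>v\<in>verts (dir G). x v + y v)"
  by (simp add: int_vectors_def integer_group_def)

lemma comm_group_int_vectors: "comm_group (int_vectors G)"
proof -
  have "group (int_vectors G)"
    by (simp add: int_vectors_def)
  then show ?thesis
    by (rule group.group_comm_groupI) (simp add: mult_int_vectors add.commute)
qed

lemma mat_vec_carrier: "mat_vec (verts (dir G)) J M x \<in> carrier (int_vectors G)"
  by (simp add: mat_vec_def carrier_int_vectors)

lemma mat_vec_hom:
  "mat_vec (verts (dir H)) (verts (dir G)) M \<in> hom (int_vectors G) (int_vectors H)"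
  by (rule homI)
    (auto simp: carrier_int_vectors mult_int_vectors mat_vec_def distrib_left sum.distrib fun_eq_iff
      intro!: sum.cong)

lemma laplacian_lattice_normal: "laplacian_lattice G \<lhd> int_vectors G"
proof -
  interpret comm_group "int_vectors G"
    by (rule comm_group_int_vectors)
  interpret h: group_hom "int_vectors G" "int_vectors G"
    "mat_vec (verts (dir G)) (verts (dir G)) (\<lambda>v w. laplacian G w v)"
    by unfold_locales (rule mat_vec_hom)
  have "subgroup (laplacian_lattice G) (int_vectors G)"
    unfolding laplacian_lattice_def by (rule h.img_is_subgroup)
  then show ?thesis
    by (rule subgroup_imp_normal)
qed

lemma laplacian_isomorphism:
  assumes f: "graph_isomorphism f G H"
    and u: "u \<in> verts (dir G)" and v: "v \<in> verts (dir G)"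
  shows "laplacian H (on_verts f u) (on_verts f v) = laplacian G u v"
proof -
  have bv: "bij_betw (on_verts f) (verts (dir G)) (verts (dir H))"
    and ba: "bij_betw (on_arcs f) (arcs (dir G)) (arcs (dir H))"
    and wf: "wf_digraph (dir G)"
    and th: "\<And>a. a \<in> arcs (dir G) \<Longrightarrow> tail (dir H) (on_arcs f a) = on_verts f (tail (dir G) a)"
      "\<And>a. a \<in> arcs (dir G) \<Longrightarrow> head (dir H) (on_arcs f a) = on_verts f (head (dir G) a)"
    using f by (auto simp: graph_isomorphism_def undirected_graph_def fin_digraph_def)
  have inj: "on_verts f x = on_verts f y \<longleftrightarrow> x = y"
    if "x \<in> verts (dir G)" "y \<in> verts (dir G)" for x y
    using that bv by (auto simp: bij_betw_def inj_on_def)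
  have adj: "adjacency H (on_verts f x) (on_verts f y) = adjacency G x y"
    if xy: "x \<in> verts (dir G)" "y \<in> verts (dir G)" for x y
  proof -
    let ?A = "{a \<in> arcs (dir G). tail (dir G) a = x \<and> head (dir G) a = y}"
    have "{a \<in> arcs (dir H). tail (dir H) a = on_verts f x \<and> head (dir H) a = on_verts f y}
            = on_arcs f ` ?A"
    proof (intro equalityI subsetI)
      fix b
      assume b: "b \<in> {a \<in> arcs (dir H). tail (dir H) a = on_verts f x \<and> head (dir H) a = on_verts f y}"
      then obtain a where a: "a \<in> arcs (dir G)" and ba_eq: "b = on_arcs f a"
        using ba by (auto simp: bij_betw_def)
      have "tail (dir G) a = x" "head (dir G) a = y"
        using b th[OF a] inj xy wf_digraph.wellformed[OF wf a] by (simp_all add: ba_eq)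
      then show "b \<in> on_arcs f ` ?A"
        using a ba_eq by simp
    next
      fix b
      assume "b \<in> on_arcs f ` ?A"
      then obtain a where "a \<in> ?A" "b = on_arcs f a"
        by blast
      then show "b \<in> {a \<in> arcs (dir H). tail (dir H) a = on_verts f x \<and> head (dir H) a = on_verts f y}"
        using th bij_betwE[OF ba] by simp
    qed
    moreover have "inj_on (on_arcs f) ?A"
      using ba by (auto simp: bij_betw_def inj_on_def)
    ultimately show ?thesis
      by (simp add: adjacency_def card_image)
  qed
  have "(\<Sum>w\<in>verts (dir H). adjacency H (on_verts f u) w)
          = (\<Sum>w\<in>verts (dir G). adjacency G u w)"
    using u by (subst sum.reindex_bij_betw[OF bv, symmetric]) (simp add: adj)
  then show ?thesis
    using u v by (auto simp: laplacian_def degree_matrix_def adj inj)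
qed

lemma vector_map_apply:
  assumes f: "graph_isomorphism f G H" and v: "v \<in> verts (dir G)"
  shows "vector_map f G H x (on_verts f v) = x v"
proof -
  have bv: "bij_betw (on_verts f) (verts (dir G)) (verts (dir H))"
    and fin: "finite (verts (dir G))"
    using f by (auto simp: graph_isomorphism_def undirected_graph_def dest: fin_digraph.finite_verts)
  have "on_verts f v \<in> verts (dir H)"
    using bv v by (auto simp: bij_betw_def)
  then have "vector_map f G H x (on_verts f v)
      = (\<Sum>w\<in>verts (dir G). perm_matrix f (on_verts f v) w * x w)"
    by (simp add: vector_map_def mat_vec_def)
  also have "\<dots> = (\<Sum>w\<in>verts (dir G). if w = v then x w else 0)"
    using bv v by (intro sum.cong) (auto simp: perm_matrix_def bij_betw_def inj_on_def)
  finally show ?thesis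
    using fin v by simp
qed

lemma vector_map_lattice:
  assumes f: "graph_isomorphism f G H" and l: "l \<in> laplacian_lattice G"
  shows "vector_map f G H l \<in> laplacian_lattice H"
proof -
  have bv: "bij_betw (on_verts f) (verts (dir G)) (verts (dir H))"
    using f by (simp add: graph_isomorphism_def)
  obtain z where l_eq: "l = mat_vec (verts (dir G)) (verts (dir G)) (\<lambda>v w. laplacian G w v) z"
    using l by (auto simp: laplacian_lattice_def)
  let ?r = "mat_vec (verts (dir H)) (verts (dir H)) (\<lambda>v w. laplacian H w v) (vector_map f G H z)"
  have "vector_map f G H l = ?r"
  proof (rule extensionalityI)
    show "vector_map f G H l \<in> extensional (verts (dir H))"
      by (simp add: vector_map_def mat_vec_def)
    show "?r \<in> extensional (verts (dir H))"
      by (simp add: mat_vec_def)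
    fix w assume "w \<in> verts (dir H)"
    then obtain v where v: "v \<in> verts (dir G)" and w: "w = on_verts f v"
      using bv by (auto simp: bij_betw_def)
    have "?r w = (\<Sum>u\<in>verts (dir H). laplacian H u w * vector_map f G H z u)"
      using \<open>w \<in> verts (dir H)\<close> by (simp add: mat_vec_def)
    also have "\<dots> = (\<Sum>u\<in>verts (dir G). laplacian G u v * z u)"
      unfolding w using v
      by (subst sum.reindex_bij_betw[OF bv, symmetric])
        (simp add: laplacian_isomorphism[OF f] vector_map_apply[OF f])
    also have "\<dots> = vector_map f G H l w"
      using v by (simp add: w vector_map_apply[OF f] l_eq mat_vec_def)
    finally show "vector_map f G H l w = ?r w" ..
  qed
  moreover have "vector_map f G H z \<in> carrier (int_vectors H)"
    by (simp add: vector_map_def mat_vec_carrier)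
  ultimately show ?thesis
    by (auto simp: laplacian_lattice_def)
qed

lemma critical_map_coset:
  assumes f: "graph_isomorphism f G H" and x: "x \<in> carrier (int_vectors G)"
  shows "critical_map f G H (laplacian_lattice G #>\<^bsub>int_vectors G\<^esub> x)
       = laplacian_lattice H #>\<^bsub>int_vectors H\<^esub> vector_map f G H x"
proof -
  interpret G: normal "laplacian_lattice G" "int_vectors G"
    by (rule laplacian_lattice_normal)
  interpret H: normal "laplacian_lattice H" "int_vectors H"
    by (rule laplacian_lattice_normal)
  have hom: "vector_map f G H \<in> hom (int_vectors G) (int_vectors H)"
    unfolding vector_map_def by (rule mat_vec_hom)
  have eq: "laplacian_lattice H #>\<^bsub>int_vectors H\<^esub> vector_map f G H y
      = laplacian_lattice H #>\<^bsub>int_vectors H\<^esub> vector_map f G H x"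
    if y: "y \<in> laplacian_lattice G #>\<^bsub>int_vectors G\<^esub> x" for y
  proof -
    obtain l where l: "l \<in> laplacian_lattice G" and y_eq: "y = l \<otimes>\<^bsub>int_vectors G\<^esub> x"
      using y by (auto simp: r_coset_def)
    have "vector_map f G H y = vector_map f G H l \<otimes>\<^bsub>int_vectors H\<^esub> vector_map f G H x"
      using hom l x G.subset by (auto simp: y_eq hom_def)
    then have "vector_map f G H y \<in> laplacian_lattice H #>\<^bsub>int_vectors H\<^esub> vector_map f G H x"
      using vector_map_lattice[OF f l] by (auto simp: r_coset_def)
    moreover have "vector_map f G H x \<in> carrier (int_vectors H)"
      by (simp add: vector_map_def mat_vec_carrier)
    ultimately show ?thesis
      using H.repr_independence[OF _ _ H.subgroup_axioms] by simp
  qed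
  have "x \<in> laplacian_lattice G #>\<^bsub>int_vectors G\<^esub> x"
    using G.rcos_self[OF x G.subgroup_axioms] .
  then show ?thesis
    using eq unfolding critical_map_def by blast
qed

end

theory Submission
  imports Defs
begin

text \<open>
  An automorphism that fixes every vertex acts trivially on the critical group, so naturality and
  injectivity of \<open>\<psi>\<^sub>G\<close> force it to fix every spanning tree as well. On the graph with two vertices
  and two parallel edges, the automorphism exchanging the edges fixes the vertices but exchanges
  the two spanning trees.
\<close>

text \<open>The critical group sees a graph map only through its permutation matrix. Here that
  matrix is the identity, so every representative of a coset is sent to itself, whatever happens to
  the arcs.\<close>

lemma critical_map_fixing_vertices:
  assumes f: "graph_isomorphism f G G"
    and fixed: "\<And>v. v \<in> verts (dir G) \<Longrightarrow> on_verts f v = v"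
    and c: "c \<in> carrier (critical_group G)"
  shows "critical_map f G G c = c"
proof -
  obtain x where x: "x \<in> carrier (int_vectors G)"
    and c_eq: "c = laplacian_lattice G #>\<^bsub>int_vectors G\<^esub> x"
    using c by (auto simp: critical_group_def FactGroup_def RCOSETS_def)
  have "vector_map f G G x = x"
  proof (rule extensionalityI)
    show "vector_map f G G x \<in> extensional (verts (dir G))"
      by (simp add: vector_map_def mat_vec_def)
    show "x \<in> extensional (verts (dir G))"
      using x by (simp add: carrier_int_vectors)
    show "vector_map f G G x v = x v" if "v \<in> verts (dir G)" for v
      using vector_map_apply[OF f that, of x] fixed[OF that] by simp
  qed
  then show ?thesis
    by (simp add: c_eq critical_map_coset[OF f x])
qed

text \<open>The support of \<open>\<phi>\<close> lies in \<open>B\<close>, where \<open>g\<close> is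
  the identity, so the sum defining the value at \<open>c\<close> has at most the one term
  \<open>\<phi> c\<close>.\<close>

lemma linear_extension_fixing_basis:
  assumes "\<phi> \<in> complex_span B" and "\<And>b. b \<in> B \<Longrightarrow> g b = b"
  shows "linear_extension g \<phi> = \<phi>"
proof
  fix c
  have "g b = b" if "\<phi> b \<noteq> 0" for b
    using assms that by (auto simp: complex_span_def)
  then have "{b. \<phi> b \<noteq> 0 \<and> g b = c} = (if \<phi> c \<noteq> 0 then {c} else {})"
    by auto
  then show "linear_extension g \<phi> c = \<phi> c"
    by (simp add: linear_extension_def)
qed

lemma linear_extension_indicator:
  "linear_extension g (\<lambda>b. of_bool (b = d)) = (\<lambda>c. of_bool (c = g d))"
proof
  fix c
  have "{b. (of_bool (b = d) :: complex) \<noteq> 0 \<and> g b = c} = (if c = g d then {d} else {})"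
    by auto
  then show "linear_extension g (\<lambda>b. of_bool (b = d)) c = of_bool (c = g d)"
    by (simp add: linear_extension_def)
qed

lemma indicator_in_complex_span: "d \<in> B \<Longrightarrow> (\<lambda>b. of_bool (b = d)) \<in> complex_span B"
  by (simp add: complex_span_def)

text \<open>Naturality is applied to the basis vector of \<open>T\<close>. The right-hand side
  collapses because \<open>f\<close> acts trivially on the critical group, and injectivity of
  \<open>\<psi>\<close> then carries this back to trees.\<close>

lemma natural_isomorphism_fixes_trees:
  assumes iso: "vector_space_isomorphism \<psi>
      (complex_span (spanning_trees G)) (complex_span (torsion_critical_group G))"
    and natural: "\<And>\<phi>. \<phi> \<in> complex_span (spanning_trees G) \<Longrightarrow>
      \<psi> (tree_map f \<phi>) = critical_linear_map f G G (\<psi> \<phi>)"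
    and f: "graph_isomorphism f G G"
    and fixed: "\<And>v. v \<in> verts (dir G) \<Longrightarrow> on_verts f v = v"
    and T: "T \<in> spanning_trees G" and fT: "on_arcs f ` T \<in> spanning_trees G"
  shows "on_arcs f ` T = T"
proof -
  let ?\<delta> = "\<lambda>T. (\<lambda>S. of_bool (S = T)) :: _ \<Rightarrow> complex"
  have bij: "bij_betw \<psi> (complex_span (spanning_trees G)) (complex_span (torsion_critical_group G))"
    using iso by (simp add: vector_space_isomorphism_def)
  have "\<psi> (?\<delta> (on_arcs f ` T)) = critical_linear_map f G G (\<psi> (?\<delta> T))"
    using natural[OF indicator_in_complex_span[OF T]]
    by (simp add: tree_map_def linear_extension_indicator)
  also have "\<dots> = \<psi> (?\<delta> T)"
    unfolding critical_linear_map_def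
  proof (rule linear_extension_fixing_basis)
    show "\<psi> (?\<delta> T) \<in> complex_span (torsion_critical_group G)"
      using bij indicator_in_complex_span[OF T] by (rule bij_betw_apply)
    show "critical_map f G G c = c" if "c \<in> torsion_critical_group G" for c
      using that by (intro critical_map_fixing_vertices[OF f fixed]) (auto simp: torsion_critical_group_def)
  qed
  finally have "?\<delta> (on_arcs f ` T) = ?\<delta> T"
    using bij indicator_in_complex_span[OF T] indicator_in_complex_span[OF fT]
    by (auto simp: bij_betw_def dest: inj_onD)
  \<comment> \<open>At \<open>T\<close> the indicator of \<open>T\<close> is 1, so the other
    indicator must also be 1 there.\<close>
  from fun_cong[OF this, of T] show ?thesis
    by (simp split: if_splits)
qed

text \<open>Connectedness means strong connectedness of the symmetric closure, where
  \<open>e\<close> can be traversed both ways between the only vertices.\<close>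

lemma connected_if_arc_spans:
  assumes "e \<in> arcs D" and "verts D = {tail D e, head D e}"
  shows "Digraph_Component.connected D"
proof -
  let ?S = "with_proj (mk_symmetric D)"
  have V: "verts ?S = {tail D e, head D e}"
    using assms by (simp add: mk_symmetric_def)
  have "(tail D e, head D e) \<in> arcs_ends ?S" "(head D e, tail D e) \<in> arcs_ends ?S"
    using assms by (auto simp: parcs_mk_symmetric)
  then have "u \<rightarrow>\<^sup>*\<^bsub>?S\<^esub> v" if "u \<in> verts ?S" "v \<in> verts ?S" for u v
    using that unfolding reachable_def V
    by (auto intro: rtrancl_on_refl rtrancl_on_into_rtrancl_on)
  then show ?thesis
    unfolding connected_def by (intro strongly_connectedI) (simp_all add: V assms(2))
qed

text \<open>A cycle may not use both orientations of the edge, so it would repeat a single arc; an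
  arc that is not a loop cannot close up.\<close>

lemma spanning_tree_if_edge_spans:
  assumes G: "undirected_graph G" and a: "a \<in> arcs (dir G)"
    and V: "verts (dir G) = {tail (dir G) a, head (dir G) a}"
    and not_loop: "tail (dir G) a \<noteq> head (dir G) a"
  shows "{a, reversal G a} \<in> spanning_trees G"
proof -
  interpret bidirected_digraph "dir G" "reversal G"
    using G by (simp add: undirected_graph_def)
  let ?D = "spanning_subgraph G {a, reversal G a}"
  have "Digraph_Component.connected ?D"
    using V by (intro connected_if_arc_spans[of a]) (auto simp: spanning_subgraph_def)
  moreover have "\<not> undirected_cycle G {a, reversal G a} p" for p
  proof
    assume p: "undirected_cycle G {a, reversal G a} p"
    then obtain u where walk: "pre_digraph.awalk ?D u p u" and ne: "p \<noteq> []"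
      by (auto simp: undirected_cycle_def pre_digraph.cycle_def)
    have sub: "set p \<subseteq> {a, reversal G a}"
      using walk by (auto simp: pre_digraph.awalk_def spanning_subgraph_def)
    \<comment> \<open>If \<open>a\<close> occurs in \<open>p\<close>, its reversal does not, and
      \<open>b\<close> is \<open>a\<close>; otherwise \<open>b\<close> is
      \<open>reversal G a\<close>.\<close>
    obtain b where b: "b \<in> {a, reversal G a}" and eq: "set p \<subseteq> {b}"
      using p sub unfolding undirected_cycle_def by blast
    \<comment> \<open>Each step of the walk traverses \<open>b\<close>, so it starts at the tail and ends at the head of \<open>b\<close>.\<close>
    have ends: "u = tail (dir G) b \<and> v = head (dir G) b"
      if "pre_digraph.cas ?D u p v" "p \<noteq> []" "set p \<subseteq> {b}" for u v p
      using that
    \<comment> \<open>The start varies because the rest of the walk begins at the head of its first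
      arc.\<close>
    proof (induction p arbitrary: u)
      case (Cons e p)
      then show ?case
        by (cases p) (auto simp: pre_digraph.cas.simps spanning_subgraph_def)
    qed simp
    have "tail (dir G) b = head (dir G) b"
      using ends[of u p u] walk ne eq by (auto simp: pre_digraph.awalk_def)
    then show False
      using b a not_loop by auto
  qed
  ultimately show ?thesis
    using a by (auto simp: spanning_trees_def)
qed

text \<open>The parallel undirected edges are \<open>{0, 1}\<close> and \<open>{2, 3}\<close>; the
  parity of an arc encodes its direction.\<close>

definition digon :: "(nat, nat) multigraph" where
  "digon = \<lparr>dir = \<lparr>verts = {0, 1}, arcs = {0, 1, 2, 3},
                    tail = (\<lambda>a. if even a then 0 else 1), head = (\<lambda>a. if even a then 1 else 0)\<rparr>,
            reversal = id(0 := 1, 1 := 0, 2 := 3, 3 := 2)\<rparr>"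

text \<open>Shifting arcs by 2 preserves parity, hence tails and heads, which makes the identity on
  vertices compatible with the swap.\<close>

definition exchange_edges :: "(nat, nat, nat, nat) graph_map" where
  "exchange_edges = \<lparr>on_verts = id, on_arcs = id(0 := 2, 1 := 3, 2 := 0, 3 := 1)\<rparr>"

lemma undirected_graph_digon: "undirected_graph digon"
  unfolding undirected_graph_def
proof
  show "fin_digraph (dir digon)"
    by unfold_locales (auto simp: digon_def)
  then interpret fin_digraph "dir digon" .
  show "bidirected_digraph (dir digon) (reversal digon)"
    by (rule bidirected_digraphI) (auto simp: digon_def)
qed

lemma connected_digon: "Digraph_Component.connected (dir digon)"
  by (rule connected_if_arc_spans[of 0]) (auto simp: digon_def)

lemma graph_isomorphism_exchange_edges: "graph_isomorphism exchange_edges digon digon"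
  unfolding graph_isomorphism_def using undirected_graph_digon
  by (auto simp: exchange_edges_def digon_def bij_betw_def inj_on_def)

lemma spanning_trees_digon: "{0, 1} \<in> spanning_trees digon" "{2, 3} \<in> spanning_trees digon"
  using spanning_tree_if_edge_spans[OF undirected_graph_digon, of 0]
    spanning_tree_if_edge_spans[OF undirected_graph_digon, of 2]
  by (simp_all add: digon_def)

theorem theorem8p1:
  shows "\<exists>G :: (nat, nat) multigraph.
    undirected_graph G \<and> Digraph_Component.connected (dir G) \<and>
    \<not> (\<exists>\<psi> :: (nat, nat) multigraph \<Rightarrow> (nat set \<Rightarrow> complex) \<Rightarrow> ((nat \<Rightarrow> int) set \<Rightarrow> complex).
        (\<forall>H. isomorphic_graphs G H \<longrightarrow>
           vector_space_isomorphism (\<psi> H)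
             (complex_span (spanning_trees H)) (complex_span (torsion_critical_group H))) \<and>
        (\<forall>H H' f. isomorphic_graphs G H \<and> isomorphic_graphs G H' \<and> graph_isomorphism f H H' \<longrightarrow>
           (\<forall>\<phi> \<in> complex_span (spanning_trees H).
              \<psi> H' (tree_map f \<phi>) = critical_linear_map f H H' (\<psi> H \<phi>))))"
proof (intro exI[of _ digon] conjI notI undirected_graph_digon connected_digon, elim exE conjE)
  fix \<psi> :: "(nat, nat) multigraph \<Rightarrow> (nat set \<Rightarrow> complex) \<Rightarrow> ((nat \<Rightarrow> int) set \<Rightarrow> complex)"
  assume iso: "\<forall>H. isomorphic_graphs digon H \<longrightarrow> vector_space_isomorphism (\<psi> H)
      (complex_span (spanning_trees H)) (complex_span (torsion_critical_group H))"
    and natural: "\<forall>H H' f. isomorphic_graphs digon H \<and> isomorphic_graphs digon H' \<and>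
      graph_isomorphism f H H' \<longrightarrow> (\<forall>\<phi> \<in> complex_span (spanning_trees H).
        \<psi> H' (tree_map f \<phi>) = critical_linear_map f H H' (\<psi> H \<phi>))"
  have self: "isomorphic_graphs digon digon"
    using graph_isomorphism_exchange_edges by (auto simp: isomorphic_graphs_def)
  have image: "on_arcs exchange_edges ` {0, 1} = {2, 3}"
    by (simp add: exchange_edges_def)
  have "on_arcs exchange_edges ` {0, 1} = {0, 1}"
  \<comment> \<open>Naturality is invoked for the single automorphism \<open>exchange_edges\<close>,
    with both graphs equal to \<open>digon\<close>.\<close>
  proof (rule natural_isomorphism_fixes_trees[where G = digon and \<psi> = "\<psi> digon"])
    show "\<psi> digon (tree_map exchange_edges \<phi>)
        = critical_linear_map exchange_edges digon digon (\<psi> digon \<phi>)"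
      if "\<phi> \<in> complex_span (spanning_trees digon)" for \<phi>
      using natural self graph_isomorphism_exchange_edges that by blast
    show "on_verts exchange_edges v = v" for v
      by (simp add: exchange_edges_def)
  qed (use iso self graph_isomorphism_exchange_edges spanning_trees_digon image in auto)
  then show False
    unfolding image by (simp add: doubleton_eq_iff)
qed

end
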